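(* For any positive integer $t$, every triangle-free graph of tree-width at most $t$ has chromatic number at most $\lceil (t+3)/2\rceil$.
   Context: Graphs are finite and simple. A tree decomposition of a graph $G$ is a pair $(T,\beta)$, where $T$ is a tree and $\beta$ is a function assigning to each vertex of $T$ a set of vertices of $G$, such that for every $uv\in E(G)$ there exists $z\in V(T)$ with $\{u,v\}\subseteq\beta(z)$, and such that for every $v\in V(G)$, the set $\{z\in V(T):v\in\beta(z)\}$ induces a non-empty connected subtree of $T$. The width of the decomposition is the maximum of $|\beta(z)|-1$ over all $z\in V(T)$, and the tree-width of $G$ is the minimum possible width of a tree decomposition of $G$. A graph is triangle-free if it contains no $K_3$ as a subgraph. *)

theory Defs
  imports Complex_Main "Graph_Theory.Graph_Theory"
begin

text \<open>
  Finite simple graphs are the finite, loop-free, symmetric digraphs without parallel arcs of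
  the locale \<^locale>\<open>graph\<close>; an edge \<open>uv\<close> is a pair of opposite arcs, that is,
  \<open>(u, v)\<close> and \<open>(v, u)\<close> both belong to \<open>arcs_ends G\<close>.
\<close>

text \<open>
  The library's \<^const>\<open>forest\<close> and \<^const>\<open>tree\<close> refer to directed cycles, so that an arc followed by
  its reverse counts as a cycle and no symmetric digraph with an arc is a forest.  The cycles
  of a simple graph are exactly the directed cycles of length at least 3.
\<close>

definition graph_tree :: "('a, 'b) pre_digraph \<Rightarrow> bool" where
  "graph_tree T \<longleftrightarrow> graph T \<and> Digraph_Component.connected T \<and>
     \<not> (\<exists>p. pre_digraph.cycle T p \<and> 3 \<le> length p)"

text \<open>
  A tree has at least one vertex, because \<^const>\<open>Digraph_Component.connected\<close> excludes the empty graph.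
\<close>

definition tree_decomposition ::
    "('a, 'b) pre_digraph \<Rightarrow> ('c, 'd) pre_digraph \<Rightarrow> ('c \<Rightarrow> 'a set) \<Rightarrow> bool" where
  "tree_decomposition G T \<beta> \<longleftrightarrow>
     graph_tree T \<and>
     (\<forall>z \<in> verts T. \<beta> z \<subseteq> verts G) \<and>
     (\<forall>(u, v) \<in> arcs_ends G. \<exists>z \<in> verts T. {u, v} \<subseteq> \<beta> z) \<and>
     (\<forall>v \<in> verts G. graph_tree (T \<restriction> {z \<in> verts T. v \<in> \<beta> z}))"

text \<open>The width is an integer: the empty graph has tree-width \<open>-1\<close>.\<close>

definition decomposition_width :: "('c, 'd) pre_digraph \<Rightarrow> ('c \<Rightarrow> 'a set) \<Rightarrow> int" where
  "decomposition_width T \<beta> = Max ((\<lambda>z. int (card (\<beta> z)) - 1) ` verts T)"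

text \<open>
  Trees on natural numbers suffice, since every finite tree is isomorphic to one of these.
\<close>

definition treewidth :: "('a, 'b) pre_digraph \<Rightarrow> int" where
  "treewidth G = (LEAST w. \<exists>(T :: nat pair_pre_digraph) \<beta>.
     tree_decomposition G (with_proj T) \<beta> \<and> decomposition_width (with_proj T) \<beta> = w)"

definition triangle_free :: "('a, 'b) pre_digraph \<Rightarrow> bool" where
  "triangle_free G \<longleftrightarrow> \<not> (\<exists>H. subgraph H G \<and> complete_digraph 3 H)"

definition proper_coloring :: "('a, 'b) pre_digraph \<Rightarrow> nat \<Rightarrow> ('a \<Rightarrow> nat) \<Rightarrow> bool" where
  "proper_coloring G k c \<longleftrightarrow>
     (\<forall>v \<in> verts G. c v < k) \<and> (\<forall>(u, v) \<in> arcs_ends G. c u \<noteq> c v)"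

definition chromatic_number :: "('a, 'b) pre_digraph \<Rightarrow> nat" where
  "chromatic_number G = (LEAST k. \<exists>c. proper_coloring G k c)"

end

theory Submission
  imports Defs
begin

text \<open>
  Let \<open>2 m \<ge> t + 1\<close>. The vertices are coloured greedily from \<open>m + 1\<close> colours along the tree, keeping
  each bag covered by at most \<open>m\<close> sets that are edges or monochromatic. An independent subset of such
  a bag sees at most \<open>m\<close> colours, and the neighbours of a new vertex in the bag are independent as
  there are no triangles; so some colour is always free. To restore the cover after adding \<open>v\<close> to a
  bag with fewer than \<open>2 m\<close> vertices, take a cover with the fewest edges. If it has no spare set,
  then by counting it contains a singleton \<open>{x}\<close>. If \<open>x\<close> is a neighbour of \<open>v\<close>, then
  \<open>{v, x}\<close> is the new covering edge. Otherwise \<open>v\<close> takes the colour of \<open>x\<close>: a neighbour of \<open>v\<close> with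
  this colour would lie on a covering edge, and dissolving this edge costs no additional set,
  against minimality.
\<close>

section \<open>Vertex sets of matchings\<close>

text \<open>Only the vertex set \<open>D\<close> of a matching is kept: the number of edges is
  \<open>card D / 2\<close>, and an edge can be recovered from an endpoint.\<close>

inductive perfectly_matched :: "('a \<times> 'a) set \<Rightarrow> 'a set \<Rightarrow> bool" for E where
  empty: "perfectly_matched E {}"
| insert: "perfectly_matched E D \<Longrightarrow> (u, w) \<in> E \<Longrightarrow> u \<notin> D \<Longrightarrow> w \<notin> D \<Longrightarrow> u \<noteq> w \<Longrightarrow>
    perfectly_matched E (insert u (insert w D))"

lemma perfectly_matched_finite: "perfectly_matched E D \<Longrightarrow> finite D"
  by (induction rule: perfectly_matched.induct) auto

lemma perfectly_matched_even_card: "perfectly_matched E D \<Longrightarrow> even (card D)"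
  by (induction rule: perfectly_matched.induct) (auto dest: perfectly_matched_finite)

text \<open>\<open>z\<close> is the partner of \<open>y\<close> in a matching that the derivation
  builds. This is how a covering edge gets dissolved.\<close>

lemma perfectly_matched_remove:
  assumes "perfectly_matched E D" "y \<in> D"
  obtains z where "z \<in> D" "z \<noteq> y" "perfectly_matched E (D - {y, z})"
    "card D = card (D - {y, z}) + 2"
proof -
  have "\<exists>z\<in>D. z \<noteq> y \<and> perfectly_matched E (D - {y, z})"
    using assms
  proof (induction rule: perfectly_matched.induct)
    case (insert D u w)
    show ?case
    proof (cases "y \<in> D")
      case True
      then obtain z where z: "z \<in> D" "z \<noteq> y" "perfectly_matched E (D - {y, z})"
        using insert by blast
      have "insert u (insert w D) - {y, z} = insert u (insert w (D - {y, z}))"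
        using insert True z by auto
      moreover have "perfectly_matched E (insert u (insert w (D - {y, z})))"
        using insert z by (intro perfectly_matched.insert) auto
      ultimately have "perfectly_matched E (insert u (insert w D) - {y, z})"
        by (simp only:)
      then show ?thesis
        using z(1,2) by blast
    next
      case False
      then consider "y = u" | "y = w"
        using insert.prems by blast
      then show ?thesis
      proof cases
        case 1
        have "insert u (insert w D) - {y, w} = D"
          using 1 insert.hyps by blast
        then show ?thesis
          using 1 insert.hyps by (intro bexI[of _ w] conjI) (simp_all only:, simp_all)
      next
        case 2
        have "insert u (insert w D) - {y, u} = D"
          using 2 insert.hyps by blast
        then show ?thesis
          using 2 insert.hyps by (intro bexI[of _ u] conjI) (simp_all only:, simp_all)
      qed
    qed
  qed simp
  then obtain z where z: "z \<in> D" "z \<noteq> y" "perfectly_matched E (D - {y, z})"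
    by blast
  have "finite D"
    using assms perfectly_matched_finite by blast
  have "card (insert y (insert z (D - {y, z}))) = card (D - {y, z}) + 2"
    using z \<open>finite D\<close> by simp
  moreover have "insert y (insert z (D - {y, z})) = D"
    using z assms by auto
  ultimately show ?thesis
    using that z by simp
qed

text \<open>Each matching edge has at most one endpoint in the independent set
  \<open>I\<close>.\<close>

lemma perfectly_matched_independent:
  assumes "perfectly_matched E D" "\<forall>u\<in>I. \<forall>w\<in>I. (u, w) \<notin> E"
  shows "2 * card (I \<inter> D) \<le> card D"
  using assms
proof (induction rule: perfectly_matched.induct)
  case (insert D u w)
  have fin: "finite D"
    using insert perfectly_matched_finite by blast
  have "card (I \<inter> insert u (insert w D)) \<le> Suc (card (I \<inter> D))"
  proof (cases "u \<in> I")
    case True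
    then have "I \<inter> insert u (insert w D) = insert u (I \<inter> D)"
      using insert by auto
    then show ?thesis
      using fin by (simp add: card_insert_le_m1 card_insert_if)
  next
    case False
    then have "I \<inter> insert u (insert w D) \<subseteq> insert w (I \<inter> D)"
      by auto
    then have "card (I \<inter> insert u (insert w D)) \<le> card (insert w (I \<inter> D))"
      using fin by (intro card_mono) auto
    then show ?thesis
      using fin by (simp add: card_insert_if split: if_splits)
  qed
  then show ?case
    using insert fin by simp
qed simp

section \<open>Covers by edges and colour classes\<close>

text \<open>
  \<open>D\<close> is the union of the covering edges, the other covering sets are the colour classes of
  \<open>B - D\<close>, and the inequality is doubled because there are \<open>card D / 2\<close> edges.
\<close>

definition covered :: "('a \<times> 'a) set \<Rightarrow> nat \<Rightarrow> ('a \<Rightarrow> 'c) \<Rightarrow> 'a set \<Rightarrow> bool" where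
  "covered E m c B \<longleftrightarrow>
     (\<exists>D\<subseteq>B. perfectly_matched E D \<and> 2 * card (c ` (B - D)) + card D \<le> 2 * m)"

lemma coveredI:
  "D \<subseteq> B \<Longrightarrow> perfectly_matched E D \<Longrightarrow> 2 * card (c ` (B - D)) + card D \<le> 2 * m \<Longrightarrow> covered E m c B"
  unfolding covered_def by blast

lemma covered_cong:
  assumes "\<And>u. u \<in> B \<Longrightarrow> c u = c' u"
  shows "covered E m c B \<longleftrightarrow> covered E m c' B"
proof -
  have "c ` (B - D) = c' ` (B - D)" for D
    using assms by (intro image_cong) auto
  then show ?thesis
    unfolding covered_def by simp
qed

lemma covered_empty: "covered E m c {}"
  by (rule coveredI[of "{}"]) (auto intro: perfectly_matched.empty)

text \<open>If \<open>x\<close> lies on a covering edge, that edge is dissolved. Its other endpoint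
  \<open>z\<close> then adds at most one colour class, so the number of covering sets does not
  grow.\<close>

lemma covered_remove:
  assumes "covered E m c B" "finite B"
  shows "covered E m c (B - {x})"
proof -
  obtain D where D: "D \<subseteq> B" "perfectly_matched E D" "2 * card (c ` (B - D)) + card D \<le> 2 * m"
    using assms(1) unfolding covered_def by blast
  show ?thesis
  proof (cases "x \<in> D")
    case False
    have "card (c ` (B - {x} - D)) \<le> card (c ` (B - D))"
      using assms(2) by (intro card_mono image_mono) auto
    then show ?thesis
      using D False by (intro coveredI[of D]) auto
  next
    case True
    then obtain z where z: "z \<in> D" "z \<noteq> x" "perfectly_matched E (D - {x, z})"
      "card D = card (D - {x, z}) + 2"
      using perfectly_matched_remove D(2) by metis
    have "c ` (B - {x} - (D - {x, z})) = insert (c z) (c ` (B - D))"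
      using z True D by auto
    then have "card (c ` (B - {x} - (D - {x, z}))) \<le> Suc (card (c ` (B - D)))"
      by (metis card_insert_le_m1 card_insert_if finite_imageI assms(2) finite_Diff le_Suc_eq order_refl)
    then show ?thesis
      using D z by (intro coveredI[of "D - {x, z}"]) auto
  qed
qed

lemma covered_subset:
  assumes "covered E m c B" "finite B" "B' \<subseteq> B"
  shows "covered E m c B'"
proof -
  have "covered E m c (B - X)" if "finite X" for X
    using that
  proof (induction X)
    case (insert x X)
    show ?case
      by (subst Diff_insert) (intro covered_remove insert.IH finite_Diff assms(2))
  qed (simp add: assms(1))
  from this[of "B - B'"] have "covered E m c (B - (B - B'))"
    using assms(2) by blast
  also have "B - (B - B') = B'"
    using assms(3) by blast
  finally show ?thesis .
qed

text \<open>Every covering set contributes at most one colour to \<open>I\<close>: an edge meets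
  \<open>I\<close> in at most one vertex, and a colour class has a single colour.\<close>

lemma covered_independent_colors:
  assumes "covered E m c B" "finite B" "I \<subseteq> B" "\<forall>u\<in>I. \<forall>w\<in>I. (u, w) \<notin> E"
  shows "card (c ` I) \<le> m"
proof -
  obtain D where D: "D \<subseteq> B" "perfectly_matched E D" "2 * card (c ` (B - D)) + card D \<le> 2 * m"
    using assms(1) unfolding covered_def by blast
  have fin: "finite (I \<inter> D)"
    using assms finite_subset by blast
  have "card (c ` I) \<le> card (c ` (B - D) \<union> c ` (I \<inter> D))"
    using assms fin by (intro card_mono) auto
  also have "\<dots> \<le> card (c ` (B - D)) + card (c ` (I \<inter> D))"
    by (rule card_Un_le)
  also have "card (c ` (I \<inter> D)) \<le> card (I \<inter> D)"
    using fin by (rule card_image_le)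
  finally show ?thesis
    using D(3) perfectly_matched_independent[OF D(2) assms(4)] by linarith
qed

lemma ex_unique_color:
  assumes "finite U" "card U < 2 * card (c ` U)"
  shows "\<exists>x\<in>U. \<forall>y\<in>U. c y = c x \<longrightarrow> y = x"
proof (rule ccontr)
  assume no: "\<not> ?thesis"
  have "2 \<le> card {x \<in> U. c x = a}" if a: "a \<in> c ` U" for a
  proof -
    obtain x where x: "x \<in> U" "a = c x"
      using a by blast
    then obtain y where y: "y \<in> U" "c y = c x" "y \<noteq> x"
      using no by blast
    have "card {x, y} \<le> card {x \<in> U. c x = a}"
      using x y assms(1) by (intro card_mono) auto
    then show ?thesis
      using y by simp
  qed
  then have "(\<Sum>a\<in>c ` U. 2) \<le> (\<Sum>a\<in>c ` U. card {x \<in> U. c x = a})"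
    by (rule sum_mono)
  also have "\<dots> = card U"
    using sum.image_gen[OF assms(1), of "\<lambda>_. 1::nat" c] by simp
  finally show False
    using assms(2) by simp
qed

section \<open>Colouring one more vertex\<close>

text \<open>In use, \<open>N\<close> consists of all neighbours of \<open>v\<close> in
  \<open>B\<close>, so that \<open>a\<close> is a proper colour for \<open>v\<close>. The cases are
  a spare covering set, a singleton \<open>{x}\<close> with \<open>x\<close> in \<open>N\<close>,
  and a singleton \<open>{x}\<close> with \<open>x\<close> outside \<open>N\<close>.\<close>

lemma covered_extend_vertex:
  fixes c :: "'a \<Rightarrow> nat"
  assumes cov: "covered E m c B" and fin: "finite B" and card: "card B < 2 * m" and v: "v \<notin> B"
    and N: "N \<subseteq> B" "\<forall>u\<in>N. \<forall>w\<in>N. (u, w) \<notin> E" "\<forall>u\<in>N. (v, u) \<in> E"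
    and range: "c ` B \<subseteq> {..m}"
  obtains a where "a \<le> m" "a \<notin> c ` N" "covered E m (c(v := a)) (insert v B)"
proof -
  let ?P = "\<lambda>D. D \<subseteq> B \<and> perfectly_matched E D \<and> 2 * card (c ` (B - D)) + card D \<le> 2 * m"
  obtain D0 where "?P D0"
    using cov unfolding covered_def by blast
  \<comment> \<open>A cover with the fewest edges; minimality enters only in the last case.\<close>
  then obtain D where D: "?P D" and min: "\<And>D'. ?P D' \<Longrightarrow> card D \<le> card D'"
    using ex_has_least_nat[of ?P D0 card] by blast
  have finD: "finite D"
    using D fin finite_subset by blast
  have vD: "v \<notin> D"
    using D v by blast
  have img: "c(v := a) ` (insert v B - D') = insert a (c ` (B - D'))" if "v \<notin> D'" for a D'
    using that v by (auto simp: image_iff)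
  \<comment> \<open>\<open>N\<close> sees at most \<open>m\<close> of the \<open>m + 1\<close>
    colours, so some colour \<open>b\<close> is free.\<close>
  have "card (c ` N) < card {..m}"
    using covered_independent_colors[OF cov fin N(1,2)] by simp
  then have "\<not> {..m} \<subseteq> c ` N"
    using N(1) fin by (meson card_mono finite_imageI finite_subset leD)
  then obtain b where b: "b \<le> m" "b \<notin> c ` N"
    by auto
  show thesis
  proof (cases "2 * card (c ` (B - D)) + card D < 2 * m")
    case True
    \<comment> \<open>Both sides of the strict inequality are even, so the gap is at least 2, which
      pays for one more colour class.\<close>
    moreover have "even (card D)"
      using D perfectly_matched_even_card by blast
    ultimately have slack: "2 * card (c ` (B - D)) + card D + 2 \<le> 2 * m"
      by presburger
    have "card (insert b (c ` (B - D))) \<le> Suc (card (c ` (B - D)))"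
      using fin by (simp add: card_insert_if)
    then have "2 * card (c(v := b) ` (insert v B - D)) + card D \<le> 2 * m"
      unfolding img[OF vD] using slack by linarith
    then have "covered E m (c(v := b)) (insert v B)"
      using D by (intro coveredI[of D]) auto
    then show ?thesis
      using that b by blast
  next
    case False
    \<comment> \<open>Without slack, \<open>card B < 2 * m\<close> leaves fewer than two vertices
      per colour outside \<open>D\<close>.\<close>
    have "card (B - D) + card D = card B"
      using D fin finD by (simp add: card_Diff_subset card_mono)
    then have "card (B - D) < 2 * card (c ` (B - D))"
      using False card by linarith
    then obtain x where x: "x \<in> B - D" "\<forall>y\<in>B - D. c y = c x \<longrightarrow> y = x"
      using ex_unique_color[of "B - D" c] fin by blast
    show ?thesis
    proof (cases "x \<in> N")
      case True
      \<comment> \<open>The edge \<open>{v, x}\<close> replaces the colour class \<open>{x}\<close>,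
        so the number of covering sets is unchanged and any free colour will do.\<close>
      let ?D = "insert v (insert x D)"
      have "perfectly_matched E ?D"
        using D x v N(3) True by (intro perfectly_matched.insert) auto
      moreover have "card ?D = card D + 2"
        using finD x v D by (subst card_insert_disjoint) auto
      moreover have "card (c(v := b) ` (insert v B - ?D)) + 1 \<le> card (c ` (B - D))"
      proof -
        have "c(v := b) ` (insert v B - ?D) \<subseteq> c ` (B - D) - {c x}"
          using x v by auto
        then have "card (c(v := b) ` (insert v B - ?D)) \<le> card (c ` (B - D) - {c x})"
          using fin by (intro card_mono) auto
        moreover have "card (c ` (B - D) - {c x}) + 1 = card (c ` (B - D))"
          using x fin by (metis Suc_eq_plus1 card_Suc_Diff1 finite_Diff finite_imageI imageI)
        ultimately show ?thesis
          by linarith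
      qed
      ultimately have "covered E m (c(v := b)) (insert v B)"
        using D x by (intro coveredI[of ?D]) auto
      then show ?thesis
        using that b by blast
    next
      case False
      have "c x \<notin> c ` N"
      proof
        assume "c x \<in> c ` N"
        then obtain y where y: "y \<in> N" "c y = c x"
          by auto
        \<comment> \<open>\<open>x\<close> is the only vertex of its colour outside
          \<open>D\<close>, and \<open>y\<close> differs from \<open>x\<close> because
          \<open>x\<close> is not in \<open>N\<close>.\<close>
        then have "y \<in> D"
          using x False N(1) by blast
        then obtain z where z: "z \<in> D" "z \<noteq> y" "perfectly_matched E (D - {y, z})"
          "card D = card (D - {y, z}) + 2"
          using perfectly_matched_remove D by metis
        \<comment> \<open>The colour of \<open>y\<close> is already present outside \<open>D\<close>
          through \<open>x\<close>, so only \<open>z\<close> can add a colour, and the dissolved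
          edge makes up for it.\<close>
        have "c ` (B - (D - {y, z})) \<subseteq> insert (c z) (c ` (B - D))"
          using x y by (force simp: image_iff)
        then have "card (c ` (B - (D - {y, z}))) \<le> card (insert (c z) (c ` (B - D)))"
          using fin by (intro card_mono) auto
        also have "\<dots> \<le> Suc (card (c ` (B - D)))"
          using fin by (simp add: card_insert_if)
        finally have "?P (D - {y, z})"
          using z D by auto
        from min[OF this] show False
          using z(4) by linarith
      qed
      \<comment> \<open>\<open>v\<close> joins the class of \<open>x\<close>, so no new class
        arises.\<close>
      moreover have "2 * card (c(v := c x) ` (insert v B - D)) + card D \<le> 2 * m"
        unfolding img[OF vD] using D x by (simp add: insert_absorb)
      then have "covered E m (c(v := c x)) (insert v B)"
        using D by (intro coveredI[of D]) auto
      moreover have "c x \<le> m"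
        using x range by auto
      ultimately show ?thesis
        using that by blast
    qed
  qed
qed

section \<open>Good colourings of a bag\<close>

text \<open>The invariant kept on each bag; \<open>{..m}\<close> stands for the \<open>m + 1\<close>
  available colours.\<close>

definition good_coloring :: "('a \<times> 'a) set \<Rightarrow> nat \<Rightarrow> ('a \<Rightarrow> nat) \<Rightarrow> 'a set \<Rightarrow> bool" where
  "good_coloring E m c B \<longleftrightarrow>
     covered E m c B \<and> c ` B \<subseteq> {..m} \<and> (\<forall>u\<in>B. \<forall>w\<in>B. (u, w) \<in> E \<longrightarrow> c u \<noteq> c w)"

lemma good_coloring_cong:
  assumes "\<And>u. u \<in> B \<Longrightarrow> c u = c' u"
  shows "good_coloring E m c B \<longleftrightarrow> good_coloring E m c' B"
  using assms covered_cong[of B c c' E m] unfolding good_coloring_def by auto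

lemma good_coloring_subset:
  "good_coloring E m c B \<Longrightarrow> finite B \<Longrightarrow> B' \<subseteq> B \<Longrightarrow> good_coloring E m c B'"
  using covered_subset[of E m c B B'] by (auto simp: good_coloring_def)

lemma good_coloring_empty: "good_coloring E m c {}"
  unfolding good_coloring_def by (simp add: covered_empty)

text \<open>The vertices of \<open>C - B\<close> are coloured one at a time. Before each step the
  coloured part is a proper subset of \<open>C\<close>, hence has fewer than \<open>2 * m\<close>
  vertices. Colours outside \<open>C - B\<close> stay as they are, which protects the other
  bags.\<close>

lemma good_coloring_extend:
  assumes E: "sym E" "irrefl E"
    and tri: "\<And>u v w. (u, v) \<in> E \<Longrightarrow> (v, w) \<in> E \<Longrightarrow> (u, w) \<notin> E"
    and C: "finite C" "card C \<le> 2 * m" "B \<subseteq> C" and good: "good_coloring E m c B"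
  obtains c' where "\<And>u. u \<notin> C - B \<Longrightarrow> c' u = c u" "good_coloring E m c' C"
proof -
  have "\<exists>c'. (\<forall>u. u \<notin> X \<longrightarrow> c' u = c u) \<and> good_coloring E m c' (B \<union> X)"
    if "finite X" "X \<subseteq> C - B" for X
    using that
  proof (induction X)
    case empty
    then show ?case
      using good by auto
  next
    case (insert v X)
    then obtain c1 where c1: "\<And>u. u \<notin> X \<Longrightarrow> c1 u = c u" "good_coloring E m c1 (B \<union> X)"
      by auto
    have fin: "finite (B \<union> X)"
      using C insert.hyps finite_subset by blast
    have v: "v \<notin> B \<union> X" "v \<in> C"
      using insert by auto
    have "card (B \<union> X) < card C"
      using C insert by (intro psubset_card_mono) auto
    then have card: "card (B \<union> X) < 2 * m"
      using C by linarith
    let ?N = "{u \<in> B \<union> X. (v, u) \<in> E}"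
    have "\<forall>u\<in>?N. \<forall>w\<in>?N. (u, w) \<notin> E"
      using tri by blast
    then obtain a where a: "a \<le> m" "a \<notin> c1 ` ?N"
      "covered E m (c1(v := a)) (insert v (B \<union> X))"
      using covered_extend_vertex[of E m c1 "B \<union> X" v ?N] c1(2) fin card v
      unfolding good_coloring_def by blast
    have "(c1(v := a)) u \<noteq> (c1(v := a)) w"
      if "u \<in> insert v (B \<union> X)" "w \<in> insert v (B \<union> X)" "(u, w) \<in> E" for u w
    proof -
      have "(w, u) \<in> E" "u \<noteq> w"
        using E that by (auto simp: sym_def irrefl_def)
      then show ?thesis
        using that a(2) c1(2) unfolding good_coloring_def by (auto simp: image_iff)
    qed
    then have "good_coloring E m (c1(v := a)) (B \<union> insert v X)"
      using a c1(2) unfolding good_coloring_def by auto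
    moreover have "\<forall>u. u \<notin> insert v X \<longrightarrow> (c1(v := a)) u = c u"
      using c1 by auto
    ultimately show ?case
      by blast
  qed
  from this[of "C - B"] show thesis
    using that C by (metis Diff_partition finite_Diff order_refl)
qed

section \<open>Edges of the tree as separators\<close>

text \<open>Otherwise a path from \<open>z'\<close> to \<open>z\<close> closes to a cycle of length at least 3.\<close>

lemma graph_tree_bridge:
  assumes T: "graph_tree T" and zz: "(z, z') \<in> arcs_ends T"
  shows "(z', z) \<notin> (arcs_ends T - {(z, z'), (z', z)})\<^sup>*"
proof
  assume walk: "(z', z) \<in> (arcs_ends T - {(z, z'), (z', z)})\<^sup>*"
  interpret T: graph T
    using T unfolding graph_tree_def by blast
  \<comment> \<open>\<open>T\<close> without the edge \<open>zz'\<close>, as a digraph, so that the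
    walk can be shortened to a path.\<close>
  define H where "H = T\<lparr>arcs := {e \<in> arcs T. arc_to_ends T e \<notin> {(z, z'), (z', z)}}\<rparr>"
  interpret H: wf_digraph H
    unfolding H_def by unfold_locales auto
  have ends: "arcs_ends H = arcs_ends T - {(z, z'), (z', z)}"
    unfolding H_def by (auto simp: arcs_ends_def arc_to_ends_def)
  have "z' \<in> verts H"
    using zz unfolding H_def by (auto simp: arcs_ends_def arc_to_ends_def)
  from walk have "z' \<rightarrow>\<^sup>*\<^bsub>H\<^esub> z"
  proof (induction rule: rtrancl_induct)
    case base
    then show ?case
      using \<open>z' \<in> verts H\<close> by simp
  next
    case (step y w)
    then show ?case
      using H.reachable_adj_trans ends by metis
  qed
  then obtain p where p: "H.apath z' p z"
    unfolding H.reachable_apath by blast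
  have sub: "subgraph H T"
    unfolding subgraph_def compatible_def using H.wf_digraph T.wf_digraph by (simp add: H_def)
  then have pT: "T.apath z' p z"
    using T.subgraph_apath_imp_apath p by blast
  obtain e where e: "e \<in> arcs T" "tail T e = z" "head T e = z'"
    using zz by (auto simp: arcs_ends_def arc_to_ends_def)
  have "z \<noteq> z'"
    using T.no_loops e by auto
  then have "p \<noteq> []"
    using p by (auto simp: H.apath_Nil_iff)
  \<comment> \<open>A single arc from \<open>z'\<close> to \<open>z\<close> has been deleted in
    \<open>H\<close>; hence \<open>p\<close> has length at least 2, and \<open>e # p\<close> at
    least 3.\<close>
  moreover have "p \<noteq> [a]" for a
  proof
    assume "p = [a]"
    then have "a \<in> arcs H" "tail H a = z'" "head H a = z"
      using p by (simp_all add: H.apath_Cons_iff H.apath_Nil_iff)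
    then show False
      by (simp add: H_def arc_to_ends_def)
  qed
  ultimately have "2 \<le> length p"
    by (cases p; cases "tl p") auto
  moreover have "T.cycle (e # p)"
    unfolding T.cycle_def using pT e
    by (auto simp: T.apath_def T.awalk_Cons_iff intro!: exI[of _ z])
  ultimately show False
    using T unfolding graph_tree_def by force
qed

text \<open>Reachability is restated as a reflexive transitive closure because the later arguments
  enlarge and shrink the relation by monotonicity.\<close>

lemma graph_tree_reachable:
  assumes "graph_tree T" "a \<in> verts T" "b \<in> verts T"
  shows "(a, b) \<in> (arcs_ends T)\<^sup>*"
proof -
  interpret T: graph T
    using assms unfolding graph_tree_def by blast
  have "strongly_connected T"
    using assms T.symmetric_connected_imp_strongly_connected T.sym_arcs
    unfolding graph_tree_def by blast
  then have "a \<rightarrow>\<^sup>*\<^bsub>T\<^esub> b"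
    using assms by blast
  then show ?thesis
    unfolding reachable_def by (rule rtrancl_on_rtranclI)
qed

lemma arcs_ends_induce:
  "arcs_ends (T \<restriction> X) = arcs_ends T \<inter> X \<times> X"
  by (auto simp: arcs_ends_def arc_to_ends_def induce_subgraph_def)

lemma rtrancl_crossing:
  assumes "(a, b) \<in> R\<^sup>*" "a \<in> S" "b \<notin> S"
  obtains z z' where "(z, z') \<in> R" "z \<in> S" "z' \<notin> S"
  using assms by (induction rule: rtrancl_induct) auto

text \<open>If \<open>u\<close> were missing from the bag of \<open>z\<close>, the subtree of
  \<open>u\<close> would give a walk from \<open>z'\<close> to \<open>s\<close> avoiding
  \<open>z\<close>. Continuing inside \<open>S\<close>, which avoids \<open>z'\<close>, it would
  reach \<open>z\<close> without the edge \<open>zz'\<close>, but this edge is a bridge.\<close>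

lemma tree_decomposition_separation:
  assumes td: "tree_decomposition G T \<beta>"
    and zz: "(z, z') \<in> arcs_ends T" "z' \<notin> S"
    and s: "s \<in> verts T" "(s, z) \<in> (arcs_ends T \<inter> S \<times> S)\<^sup>*" and z': "z' \<in> verts T"
  shows "\<beta> z' \<inter> \<beta> s \<subseteq> \<beta> z"
proof
  fix u assume u: "u \<in> \<beta> z' \<inter> \<beta> s"
  let ?X = "{y \<in> verts T. u \<in> \<beta> y}" and ?R = "arcs_ends T - {(z, z'), (z', z)}"
  have T: "graph_tree T" "graph_tree (T \<restriction> ?X)"
    using td u z' unfolding tree_decomposition_def by auto
  show "u \<in> \<beta> z"
  proof (rule ccontr)
    assume "u \<notin> \<beta> z"
    have "(z', s) \<in> (arcs_ends T \<inter> ?X \<times> ?X)\<^sup>*"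
      using graph_tree_reachable[OF T(2), of z' s] u s z'
      by (simp add: arcs_ends_induce)
    moreover have "(arcs_ends T \<inter> ?X \<times> ?X)\<^sup>* \<subseteq> ?R\<^sup>*"
      using \<open>u \<notin> \<beta> z\<close> by (intro rtrancl_mono) auto
    moreover have "(arcs_ends T \<inter> S \<times> S)\<^sup>* \<subseteq> ?R\<^sup>*"
      using zz by (intro rtrancl_mono) auto
    ultimately have "(z', z) \<in> ?R\<^sup>*"
      using s by (meson rtrancl_trans subsetD)
    then show False
      using graph_tree_bridge[OF T(1) zz(1)] by blast
  qed
qed

section \<open>Colouring along the tree\<close>

text \<open>A connected set \<open>S\<close> of nodes with well-coloured bags grows by one adjacent
  node \<open>z'\<close> at a time. By separation, the vertices newly coloured at \<open>z'\<close>
  occur in no bag of \<open>S\<close>.\<close>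

lemma tree_decomposition_good_coloring:
  assumes td: "tree_decomposition G T \<beta>" and G: "graph G"
    and bags: "\<And>z. z \<in> verts T \<Longrightarrow> card (\<beta> z) \<le> 2 * m"
    and tri: "\<And>u v w. (u, v) \<in> arcs_ends G \<Longrightarrow> (v, w) \<in> arcs_ends G \<Longrightarrow> (u, w) \<notin> arcs_ends G"
  obtains c where "\<And>z. z \<in> verts T \<Longrightarrow> good_coloring (arcs_ends G) m c (\<beta> z)"
proof -
  let ?E = "arcs_ends G"
  interpret G: graph G by fact
  interpret T: graph T
    using td unfolding tree_decomposition_def graph_tree_def by blast
  have gt: "graph_tree T"
    using td unfolding tree_decomposition_def by blast
  have E: "sym ?E" "irrefl ?E"
    using G.sym_arcs G.no_loops by (auto simp: symmetric_def irrefl_def arcs_ends_conv)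
  have finb: "finite (\<beta> z)" if "z \<in> verts T" for z
    using td that G.finite_verts unfolding tree_decomposition_def by (meson finite_subset)
  have ext: "\<exists>c'. (\<forall>u. u \<notin> \<beta> z - B \<longrightarrow> c' u = c u) \<and> good_coloring ?E m c' (\<beta> z)"
    if "z \<in> verts T" "B \<subseteq> \<beta> z" "good_coloring ?E m c B" for z B c
    by (rule good_coloring_extend[OF E _ finb bags that(2,3)]) (use tri that(1) in blast)+
  let ?conn = "\<lambda>S. \<forall>a\<in>S. \<forall>b\<in>S. (a, b) \<in> (arcs_ends T \<inter> S \<times> S)\<^sup>*"
  have "verts T \<noteq> {}"
    using gt unfolding graph_tree_def connected_def strongly_connected_def by simp
  then obtain r where r: "r \<in> verts T"
    by blast
  have "\<exists>S c. S \<subseteq> verts T \<and> card S = Suc n \<and> ?conn S \<and> (\<forall>s\<in>S. good_coloring ?E m c (\<beta> s))"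
    if "n < card (verts T)" for n
    using that
  proof (induction n)
    case 0
    obtain c where "good_coloring ?E m c (\<beta> r)"
      using ext[OF r, of "{}"] good_coloring_empty by blast
    then show ?case
      using r by (intro exI[of _ "{r}"] exI[of _ c]) simp
  next
    case (Suc n)
    then obtain S c where S: "S \<subseteq> verts T" "card S = Suc n" "?conn S"
      "\<forall>s\<in>S. good_coloring ?E m c (\<beta> s)"
      by auto
    then have "S \<noteq> verts T" "S \<noteq> {}"
      using Suc.prems by auto
    then obtain a b where "a \<in> S" "b \<in> verts T" "b \<notin> S"
      using S(1) by blast
    then obtain z z' where zz: "(z, z') \<in> arcs_ends T" "z \<in> S" "z' \<notin> S"
      using rtrancl_crossing[OF graph_tree_reachable[OF gt, of a b], of S] S(1) by blast
    then have z': "z' \<in> verts T" "z \<in> verts T"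
      by (auto simp: arcs_ends_conv)
    \<comment> \<open>The part of the new bag that is already coloured; it inherits a good colouring
      from the bag of \<open>z\<close>.\<close>
    let ?W = "\<beta> z' \<inter> \<beta> z"
    have "good_coloring ?E m c ?W"
      using good_coloring_subset[of ?E m c "\<beta> z" ?W] S(4) zz(2) finb z' by blast
    then obtain c' where c': "\<And>u. u \<notin> \<beta> z' - ?W \<Longrightarrow> c' u = c u" "good_coloring ?E m c' (\<beta> z')"
      using ext[OF z'(1), of ?W c] by auto
    have "good_coloring ?E m c' (\<beta> s)" if s: "s \<in> S" for s
    proof -
      have "\<beta> z' \<inter> \<beta> s \<subseteq> \<beta> z"
        using tree_decomposition_separation[OF td zz(1,3), of s] S(1,3) s zz(2) z' by blast
      \<comment> \<open>A vertex of this bag that also lies in the bag of \<open>z'\<close> is in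
        \<open>?W\<close>, where \<open>c'\<close> agrees with \<open>c\<close>.\<close>
      then have "c' u = c u" if "u \<in> \<beta> s" for u
        using c'(1) that by blast
      then show ?thesis
        using S(4) s good_coloring_cong[of "\<beta> s" c' c] by blast
    qed
    moreover have "?conn (insert z' S)"
    proof -
      let ?R = "arcs_ends T \<inter> insert z' S \<times> insert z' S"
      have old: "(a, b) \<in> ?R\<^sup>*" if "a \<in> S" "b \<in> S" for a b
      proof -
        have "(arcs_ends T \<inter> S \<times> S)\<^sup>* \<subseteq> ?R\<^sup>*"
          by (intro rtrancl_mono) auto
        then show ?thesis
          using S(3) that by blast
      qed
      have "(z, z') \<in> ?R" "(z', z) \<in> ?R"
        using zz T.graph_symmetric by auto
      then have "(a, z') \<in> ?R\<^sup>*" "(z', a) \<in> ?R\<^sup>*" if "a \<in> S" for a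
        using old[OF that zz(2)] old[OF zz(2) that]
        by (meson rtrancl.rtrancl_into_rtrancl converse_rtrancl_into_rtrancl)+
      then show ?thesis
        using old by blast
    qed
    moreover have "card (insert z' S) = Suc (Suc n)"
      using S zz finite_subset[OF S(1)] by simp
    ultimately show ?case
      using S(1) z' c'(2) by (intro exI[of _ "insert z' S"] exI[of _ c']) blast
  qed
  moreover have "0 < card (verts T)"
    using r T.finite_verts card_gt_0_iff by blast
  then obtain n where n: "card (verts T) = Suc n"
    using gr0_conv_Suc by blast
  ultimately obtain S c where S: "S \<subseteq> verts T" "card S = card (verts T)"
    "\<forall>s\<in>S. good_coloring ?E m c (\<beta> s)"
    using lessI by metis
  then have "S = verts T"
    by (simp add: card_subset_eq)
  then show thesis
    using that S by blast
qed

section \<open>Unfolding triangle-freeness and tree-width\<close>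

text \<open>Otherwise \<open>u\<close>, \<open>v\<close> and \<open>w\<close> are distinct and
  induce a complete digraph on three vertices.\<close>

lemma triangle_free_arcs_ends:
  assumes G: "graph G" and tri: "triangle_free G"
    and uv: "(u, v) \<in> arcs_ends G" and vw: "(v, w) \<in> arcs_ends G"
  shows "(u, w) \<notin> arcs_ends G"
proof
  assume uw: "(u, w) \<in> arcs_ends G"
  interpret G: graph G by fact
  let ?V = "{u, v, w}"
  have ne: "a \<noteq> b" if "(a, b) \<in> arcs_ends G" for a b
    using that G.no_loops by (auto simp: arcs_ends_conv)
  have V: "?V \<subseteq> verts G"
    using uv vw by (auto simp: arcs_ends_conv)
  have "arcs_ends (G \<restriction> ?V) = {(a, b). (a, b) \<in> ?V \<times> ?V \<and> a \<noteq> b}"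
    unfolding arcs_ends_induce using uv vw uw ne G.graph_symmetric by auto
  moreover have "card ?V = 3"
    using ne[OF uv] ne[OF vw] ne[OF uw] by simp
  moreover have ind: "induced_subgraph (G \<restriction> ?V) G"
    using V by (rule G.induced_induce)
  then have "graph (G \<restriction> ?V)"
    using digraph.graphI G.digraphI_induced sym_digraph.sym_arcs G.induced_graph_imp_graph
    by metis
  ultimately have "complete_digraph 3 (G \<restriction> ?V)"
    unfolding complete_digraph_def by simp
  moreover have "subgraph (G \<restriction> ?V) G"
    using ind by (rule induced_imp_subgraph)
  ultimately show False
    using tri unfolding triangle_free_def by blast
qed

lemma graph_tree_singleton: "graph_tree (with_proj \<lparr>pverts = {z}, parcs = {}\<rparr>)"
proof -
  let ?T = "\<lparr>pverts = {z}, parcs = {}\<rparr>"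
  have "pair_graph ?T"
    by unfold_locales (auto simp: symmetric_def arcs_ends_def sym_def)
  then interpret pair_graph ?T .
  have "mk_symmetric (with_proj ?T) = ?T"
    by (simp add: mk_symmetric_def)
  moreover have "strongly_connected (with_proj ?T)"
    by (auto simp: strongly_connected_def)
  moreover have "\<not> cycle p" for p
    by (cases p) (auto simp: cycle_def awalk_def)
  ultimately show ?thesis
    unfolding graph_tree_def connected_def using graph_axioms by simp
qed

text \<open>A \<open>LEAST\<close> over the integers is attained once the set is non-empty and
  bounded below. The decomposition with a single bag shows the former; widths are at least
  \<open>-1\<close> since a tree has a node.\<close>

lemma treewidth_le_imp_tree_decomposition:
  assumes G: "graph G" and tw: "treewidth G \<le> w"
  obtains T :: "nat pair_pre_digraph" and \<beta> where "tree_decomposition G (with_proj T) \<beta>"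
    "\<And>z. z \<in> pverts T \<Longrightarrow> int (card (\<beta> z)) \<le> w + 1"
proof -
  interpret G: graph G by fact
  define Q where "Q w' \<longleftrightarrow> (\<exists>(T :: nat pair_pre_digraph) \<beta>.
     tree_decomposition G (with_proj T) \<beta> \<and> decomposition_width (with_proj T) \<beta> = w')" for w'
  have bag: "finite (pverts T) \<and> pverts T \<noteq> {} \<and>
      (\<forall>z\<in>pverts T. int (card (\<beta> z)) \<le> decomposition_width (with_proj T) \<beta> + 1)"
    if "tree_decomposition G (with_proj T) \<beta>" for T :: "nat pair_pre_digraph" and \<beta>
  proof -
    have gt: "graph_tree (with_proj T)"
      using that unfolding tree_decomposition_def by blast
    interpret T: graph "with_proj T"
      using gt unfolding graph_tree_def by blast
    have fin: "finite (pverts T)"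
      using T.finite_verts by simp
    have "int (card (\<beta> z)) - 1 \<le> decomposition_width (with_proj T) \<beta>" if "z \<in> pverts T" for z
      unfolding decomposition_width_def using fin that by (intro Max_ge) auto
    moreover have "pverts T \<noteq> {}"
      using gt unfolding graph_tree_def connected_def strongly_connected_def by simp
    ultimately show ?thesis
      using fin by force
  qed
  have lower: "-1 \<le> w'" if "Q w'" for w'
  proof -
    obtain T :: "nat pair_pre_digraph" and \<beta> where T: "tree_decomposition G (with_proj T) \<beta>"
      "decomposition_width (with_proj T) \<beta> = w'"
      using \<open>Q w'\<close> unfolding Q_def by blast
    then obtain z where "int (card (\<beta> z)) \<le> w' + 1"
      using bag by blast
    then show ?thesis
      by linarith
  qed
  let ?T = "\<lparr>pverts = {0}, parcs = {}\<rparr> :: nat pair_pre_digraph"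
  have "tree_decomposition G (with_proj ?T) (\<lambda>_. verts G)"
    unfolding tree_decomposition_def
  proof (intro conjI)
    have restrict: "with_proj ?T \<restriction> {0} = with_proj ?T"
      by (auto simp: induce_subgraph_def with_proj_def)
    show "\<forall>v\<in>verts G. graph_tree (with_proj ?T \<restriction> {z \<in> verts (with_proj ?T). v \<in> verts G})"
    proof
      fix v assume "v \<in> verts G"
      then have bags: "{z \<in> verts (with_proj ?T). v \<in> verts G} = {0}"
        by auto
      show "graph_tree (with_proj ?T \<restriction> {z \<in> verts (with_proj ?T). v \<in> verts G})"
        unfolding bags restrict by (rule graph_tree_singleton)
    qed
    show "\<forall>(u, v)\<in>arcs_ends G. \<exists>z\<in>verts (with_proj ?T). {u, v} \<subseteq> verts G"
      by (auto simp: arcs_ends_conv)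
  qed (simp_all add: graph_tree_singleton)
  then obtain w0 where "Q w0"
    unfolding Q_def by blast
  \<comment> \<open>Shifting by one turns widths into natural numbers; as they are at least
    \<open>-1\<close>, \<open>nat\<close> preserves their order.\<close>
  then obtain w1 where w1: "Q w1" "\<And>w'. Q w' \<Longrightarrow> nat (w1 + 1) \<le> nat (w' + 1)"
    using ex_has_least_nat[of Q w0 "\<lambda>x. nat (x + 1)"] by blast
  then have "w1 \<le> w'" if "Q w'" for w'
    using lower that by fastforce
  then have "treewidth G = w1"
    unfolding treewidth_def Q_def[symmetric] using w1(1) by (intro Least_equality) auto
  moreover obtain T :: "nat pair_pre_digraph" and \<beta> where T: "tree_decomposition G (with_proj T) \<beta>"
    "decomposition_width (with_proj T) \<beta> = w1"
    using w1(1) unfolding Q_def by blast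
  ultimately have "int (card (\<beta> z)) \<le> w + 1" if "z \<in> pverts T" for z
    using bag[OF T(1)] that tw by force
  then show thesis
    using that T(1) by blast
qed

theorem theorem1:
  fixes G :: "('a, 'b) pre_digraph" and t :: nat
  assumes "t > 0"
    and "graph G"
    and "triangle_free G"
    and "treewidth G \<le> int t"
  shows "int (chromatic_number G) \<le> \<lceil>(real t + 3) / 2\<rceil>"
proof -
  \<comment> \<open>The least \<open>m\<close> with \<open>t + 1 \<le> 2 * m\<close>, where
    \<open>t + 1\<close> bounds the bag sizes; \<open>m + 1\<close> is then the claimed
    bound.\<close>
  define m where "m = (t + 2) div 2"
  obtain T :: "nat pair_pre_digraph" and \<beta> where td: "tree_decomposition G (with_proj T) \<beta>"
    and bags: "\<And>z. z \<in> pverts T \<Longrightarrow> int (card (\<beta> z)) \<le> int t + 1"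
    using treewidth_le_imp_tree_decomposition[OF assms(2,4)] by blast
  have "card (\<beta> z) \<le> 2 * m" if "z \<in> pverts T" for z
    using bags[OF that] unfolding m_def by linarith
  then obtain c where c: "\<And>z. z \<in> pverts T \<Longrightarrow> good_coloring (arcs_ends G) m c (\<beta> z)"
    using tree_decomposition_good_coloring[OF td assms(2), of m]
      triangle_free_arcs_ends[OF assms(2,3)] by auto
  \<comment> \<open>Every vertex and every edge lies in some bag, where \<open>c\<close> is
    good.\<close>
  have "proper_coloring G (m + 1) c"
    unfolding proper_coloring_def
  proof (intro conjI ballI)
    fix v assume "v \<in> verts G"
    then have "graph_tree (with_proj T \<restriction> {z \<in> pverts T. v \<in> \<beta> z})"
      using td unfolding tree_decomposition_def by simp
    then have "{z \<in> pverts T. v \<in> \<beta> z} \<noteq> {}"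
      unfolding graph_tree_def connected_def strongly_connected_def by simp
    then show "c v < m + 1"
      using c unfolding good_coloring_def by force
  next
    fix e assume e: "e \<in> arcs_ends G"
    then obtain z where "z \<in> pverts T" "{fst e, snd e} \<subseteq> \<beta> z"
      using td unfolding tree_decomposition_def by auto
    then show "case e of (u, v) \<Rightarrow> c u \<noteq> c v"
      using c[of z] e unfolding good_coloring_def by auto
  qed
  then have "chromatic_number G \<le> m + 1"
    unfolding chromatic_number_def by (intro Least_le) blast
  \<comment> \<open>This amounts to \<open>m < (t + 3) / 2\<close>, which follows from
    \<open>m \<le> (t + 2) / 2\<close>.\<close>
  moreover have "int (m + 1) \<le> \<lceil>(real t + 3) / 2\<rceil>"
    unfolding m_def le_ceiling_iff by simp
  ultimately show ?thesis
    by linarith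
qed

end
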